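(* Let $D_\infty(z)=\sum_{k=0}^\infty\frac{-1}{(z-2k)(z-2k-1)}$ on $\mathbb{C}\setminus\mathbb{Z}_{\ge0}$. Then $D_\infty$ has no zeros in $\{z\in\mathbb{C}:0<\operatorname{Re}(z)\le1,\ \operatorname{Im}(z)>0\}$. Consequently $g^*(z)=z\bigl(\psi(-z/2)-\psi((1-z)/2)\bigr)$ has no zeros in the half-plane $\operatorname{Re}(z)\le1$.
   Context: $D_\infty(z)=\sum_{j\ge0}(-1)^j/(z-j)$ with consecutive terms paired. $\psi$ is the digamma function and $g^*$ is the meromorphic continuation of $-z\int_0^1\frac{2}{1+t}t^{-z-1}dt$; one has $g^*(z)=2zD_\infty(z)$ and $g^*(0)=2$. Zeros of $g^*$ are points where it is holomorphic and vanishes. *)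

theory Defs
  imports "HOL-Complex_Analysis.Complex_Analysis"
begin

definition D_infty :: "complex \<Rightarrow> complex" where
  "D_infty z = (\<Sum>k. -1 / ((z - 2 * of_nat k) * (z - 2 * of_nat k - 1)))"

text \<open>The integral converges exactly for \<open>Re z < 0\<close>. Continuing to a \<^emph>\<open>nicely\<close> meromorphic
  function fills in removable singularities (in particular the one at \<open>0\<close>) and assigns the
  conventional value \<open>0\<close> at poles, so the continuation is unique as a total function.
  Because of that convention, a zero is a point where the function is analytic and vanishes.\<close>

definition g_star :: "complex \<Rightarrow> complex" where
  "g_star = (THE g. g nicely_meromorphic_on UNIV \<and>
     (\<forall>z. Re z < 0 \<longrightarrow>
        g z = - z * integral {0..1} (\<lambda>t::real. 2 / (1 + of_real t) * of_real t powr (- z - 1))))"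

definition is_zero_of :: "(complex \<Rightarrow> complex) \<Rightarrow> complex \<Rightarrow> bool" where
  "is_zero_of f z \<longleftrightarrow> f analytic_on {z} \<and> f z = 0"

end

theory Submission
  imports Defs
begin

text \<open>
  Write \<open>z = x + iy\<close>, \<open>R = |z|\<^sup>2\<close> and \<open>A\<^sub>j = |z - j|\<^sup>2 = j\<^sup>2 - 2jx + R\<close>. Then
  \<open>Im D(z) = -y \<Sum> (-1)\<^sup>j / A\<^sub>j\<close> and \<open>Im (z D(z)) = -y \<Sum> (-1)\<^sup>j j / A\<^sub>j\<close>.

  For \<open>x \<le> 1/2\<close> the \<open>A\<^sub>j\<close> increase, so \<open>Im D(z) \<noteq> 0\<close> off the real axis. For \<open>1/2 \<le> x \<le> 1\<close> only
  \<open>1/A\<^sub>0 - 1/A\<^sub>1\<close> has the wrong sign, and if \<open>R \<ge> 3\<close> it is outweighed by \<open>1/A\<^sub>2 - 1/A\<^sub>3\<close>. If \<open>R \<le> 3\<close>,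
  one uses \<open>z D(z)\<close> instead: the identity
  \<open>j/A\<^sub>j - (j+1)/A\<^sub>j\<^sub>+\<^sub>1 = (j(j+1) - R)/(A\<^sub>j A\<^sub>j\<^sub>+\<^sub>1)\<close> shows that, pairing
  the terms as \<open>(1,2), (3,4), (5,6), \<dots>\<close>, only the first pair can have the wrong sign, and it is
  outweighed by the next two. On the real axis the signs are evident.

  Expanding \<open>1/(1+t)\<close> under the integral gives \<open>2zD(z)\<close> for \<open>Re z < 0\<close>, and the identity theorem
  transfers this to the continuation, whose value at \<open>0\<close> is \<open>2\<close> and which has a pole at \<open>1\<close>.
\<close>

section \<open>The paired series and its digamma form\<close>

lemma D_infty_sums:
  assumes "z \<notin> \<nat>"
  shows "(\<lambda>k. 1 / (z - of_nat (2 * k)) - 1 / (z - of_nat (2 * k + 1))) sums D_infty z"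
    and "Digamma (- z / 2) - Digamma ((1 - z) / 2) = 2 * D_infty z"
proof -
  have nz: "z - of_nat j \<noteq> 0" for j
    using assms by (metis Nats_0 of_nat_in_Nats right_minus_eq)
  let ?d = "\<lambda>k. 1 / (z - of_nat (2 * k)) - 1 / (z - of_nat (2 * k + 1))"
  \<comment> \<open>\<open>Digamma w\<close> is the sum of \<open>?a w\<close> minus Euler's
    constant, which cancels in the difference of two values. The argument \<open>- z / 2\<close>
    supplies the even indices and \<open>(1 - z) / 2\<close> the odd ones.\<close>
  let ?a = "\<lambda>w k. inverse (of_nat (Suc k)) - inverse (w + of_nat k :: complex)"
  have ne: "- z / 2 \<noteq> 0" "(1 - z) / 2 \<noteq> 0"
    using nz[of 0] nz[of 1] by auto
  have "(\<lambda>k. ?a (- z / 2) k - ?a ((1 - z) / 2) k) sums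
      (suminf (?a (- z / 2)) - suminf (?a ((1 - z) / 2)))"
    by (intro sums_diff summable_sums summable_Digamma ne)
  also have "suminf (?a (- z / 2)) - suminf (?a ((1 - z) / 2)) =
      Digamma (- z / 2) - Digamma ((1 - z) / 2)"
    by (simp add: Digamma_def)
  also have "?a (- z / 2) k - ?a ((1 - z) / 2) k = 2 * ?d k" for k
  proof -
    have "- z / 2 + of_nat k = - (z - of_nat (2 * k)) / 2"
         "(1 - z) / 2 + of_nat k = - (z - of_nat (2 * k + 1)) / 2"
      by (simp_all add: field_simps)
    moreover have "inverse (- u / 2) = - (2 * (1 / u))" for u :: complex
      by (simp add: inverse_eq_divide)
    ultimately show ?thesis
      by (simp only:) (simp add: algebra_simps)
  qed
  then have "(\<lambda>k. ?a (- z / 2) k - ?a ((1 - z) / 2) k) = (\<lambda>k. 2 * ?d k)"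
    by blast
  finally have "(\<lambda>k. 1 / 2 * (2 * ?d k)) sums (1 / 2 * (Digamma (- z / 2) - Digamma ((1 - z) / 2)))"
    by (rule sums_mult)
  moreover have "1 / 2 * (2 * u) = u" for u :: complex
    by simp
  ultimately have "?d sums (1 / 2 * (Digamma (- z / 2) - Digamma ((1 - z) / 2)))"
    by (simp only:)
  then have s: "?d sums ((Digamma (- z / 2) - Digamma ((1 - z) / 2)) / 2)"
    by simp
  have "?d k = -1 / ((z - 2 * of_nat k) * (z - 2 * of_nat k - 1))" for k
    using nz[of "2 * k"] nz[of "2 * k + 1"] by (simp add: divide_simps diff_eq_eq)
  then have "D_infty z = suminf ?d"
    unfolding D_infty_def by presburger
  with s have D: "D_infty z = (Digamma (- z / 2) - Digamma ((1 - z) / 2)) / 2"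
    by (simp add: sums_iff)
  show "?d sums D_infty z" unfolding D by (rule s)
  show "Digamma (- z / 2) - Digamma ((1 - z) / 2) = 2 * D_infty z" unfolding D by simp
qed

section \<open>Sign criteria for alternating series\<close>

lemma alternating_sums_pos:
  fixes f :: "nat \<Rightarrow> real"
  assumes "(\<lambda>k. f (2 * k) - f (2 * k + 1)) sums s"
    and "\<And>k. k \<ge> m \<Longrightarrow> f (2 * k + 1) \<le> f (2 * k)"
    and "0 < (\<Sum>k<m. f (2 * k) - f (2 * k + 1))"
  shows "0 < s"
  using sum_le_suminf[OF sums_summable[OF assms(1)], of "{..<m}"] assms
  by (force simp: sums_iff)

text \<open>Regroup as \<open>f 0 - (f 1 - f 2) - (f 3 - f 4) - ...\<close>. Partial sums of the
  given pairs end with an unmatched \<open>- f (2 * n + 1)\<close>, which the nonnegativity of odd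
  terms allows to be dropped in an upper bound.\<close>

lemma alternating_sums_neg:
  fixes f :: "nat \<Rightarrow> real"
  assumes s: "(\<lambda>k. f (2 * k) - f (2 * k + 1)) sums s"
    and pos: "\<And>k. 0 \<le> f (2 * k + 1)"
    and dec: "\<And>k. k \<ge> m \<Longrightarrow> f (2 * k + 2) \<le> f (2 * k + 1)"
    and init: "f 0 < (\<Sum>k<m. f (2 * k + 1) - f (2 * k + 2))"
  shows "s < 0"
proof -
  let ?q = "\<lambda>k. f (2 * k + 1) - f (2 * k + 2)"
  have shift: "(\<Sum>k<Suc n. f (2 * k) - f (2 * k + 1)) = f 0 - (\<Sum>k<n. ?q k) - f (2 * n + 1)" for n
    by (induction n) auto
  have "(\<Sum>k<n. f (2 * k) - f (2 * k + 1)) \<le> f 0 - (\<Sum>k<m. ?q k)" if "n \<ge> Suc m" for n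
  proof -
    define n' where "n' = n - 1"
    have n': "n = Suc n'" "n' \<ge> m"
      using that by (auto simp: n'_def)
    have "(\<Sum>k<m. ?q k) \<le> (\<Sum>k<n'. ?q k)"
      by (rule sum_mono2) (use n' dec in auto)
    then show ?thesis
      using shift[of n'] pos[of n'] unfolding n'(1) by linarith
  qed
  then have "s \<le> f 0 - (\<Sum>k<m. ?q k)"
    by (intro LIMSEQ_le_const2[OF s[unfolded sums_def]]) blast
  with init show ?thesis by linarith
qed

section \<open>Imaginary parts of \<open>D_infty z\<close> and \<open>z * D_infty z\<close>\<close>

lemma Im_inverse_diff:
  "Im (1 / (z - of_nat j)) = - Im z * (1 / ((real j - Re z)\<^sup>2 + (Im z)\<^sup>2))"
  "Im z \<noteq> 0 \<Longrightarrow> Im (z * (1 / (z - of_nat j))) = - Im z * (real j / ((real j - Re z)\<^sup>2 + (Im z)\<^sup>2))"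
proof -
  have sq: "(Re z - real j)\<^sup>2 = (real j - Re z)\<^sup>2"
    by (rule power2_commute)
  show 1: "Im (1 / (z - of_nat j)) = - Im z * (1 / ((real j - Re z)\<^sup>2 + (Im z)\<^sup>2))"
    by (simp add: Im_divide sq)
  assume "Im z \<noteq> 0"
  then have "z - of_nat j \<noteq> 0"
    by (auto simp: complex_eq_iff)
  \<comment> \<open>Splitting off the real constant 1 leaves \<open>j\<close> times the previous
    fraction, hence the weight \<open>j\<close> in the imaginary part.\<close>
  then have "z * (1 / (z - of_nat j)) = 1 + of_real (real j) * (1 / (z - of_nat j))"
    by (simp add: field_simps)
  then have "Im (z * (1 / (z - of_nat j))) = real j * Im (1 / (z - of_nat j))"
    by (simp add: times_complex.sel(2)[of "of_real _"] del: times_complex.sel of_real_of_nat_eq times_divide_eq_right)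
  then show "Im (z * (1 / (z - of_nat j))) = - Im z * (real j / ((real j - Re z)\<^sup>2 + (Im z)\<^sup>2))"
    unfolding 1 by simp
qed

text \<open>Dividing by \<open>- Im z\<close> removes the common factor, so a definite sign of
  either real series rules out a zero in both half-planes at once.\<close>

lemma Im_D_infty_sums:
  assumes "Im z \<noteq> 0"
  defines "A \<equiv> \<lambda>j. (real j - Re z)\<^sup>2 + (Im z)\<^sup>2"
  shows "(\<lambda>k. 1 / A (2 * k) - 1 / A (2 * k + 1)) sums (Im (D_infty z) / - Im z)"
    and "(\<lambda>k. real (2 * k) / A (2 * k) - real (2 * k + 1) / A (2 * k + 1)) sums
           (Im (z * D_infty z) / - Im z)"
proof -
  have "z \<notin> \<nat>"
    using assms(1) by (auto elim!: Nats_cases)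
  note s = D_infty_sums(1)[OF this]
  have "Im (1 / (z - of_nat (2 * k)) - 1 / (z - of_nat (2 * k + 1))) / (- Im z) =
      1 / A (2 * k) - 1 / A (2 * k + 1)" for k
    unfolding minus_complex.sel Im_inverse_diff A_def using assms(1) by (simp add: diff_divide_distrib)
  with sums_divide[OF sums_Im[OF s], of "- Im z"]
  show "(\<lambda>k. 1 / A (2 * k) - 1 / A (2 * k + 1)) sums (Im (D_infty z) / - Im z)"
    by (simp only:)
  have "Im (z * (1 / (z - of_nat (2 * k)) - 1 / (z - of_nat (2 * k + 1)))) / (- Im z) =
      real (2 * k) / A (2 * k) - real (2 * k + 1) / A (2 * k + 1)" for k
    unfolding right_diff_distrib minus_complex.sel Im_inverse_diff(2)[OF assms(1)] A_def
    using assms(1) by (simp add: diff_divide_distrib)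
  with sums_divide[OF sums_Im[OF sums_mult[OF s, of z]], of "- Im z"]
  show "(\<lambda>k. real (2 * k) / A (2 * k) - real (2 * k + 1) / A (2 * k + 1)) sums
           (Im (z * D_infty z) / - Im z)"
    by (simp only:)
qed

section \<open>Absence of zeros off the real axis\<close>

lemma shifted_square_pos: "y \<noteq> 0 \<Longrightarrow> 0 < (u - x)\<^sup>2 + (y::real)\<^sup>2"
  by (simp add: add_nonneg_pos)

lemma D_infty_nonzero_left:
  assumes "Im z \<noteq> 0" "Re z \<le> 1 / 2"
  shows "D_infty z \<noteq> 0"
proof -
  define A where "A = (\<lambda>j::nat. (real j - Re z)\<^sup>2 + (Im z)\<^sup>2)"
  have A: "0 < A j" for j
    unfolding A_def using assms(1) by (rule shifted_square_pos)
  have mono: "A j \<le> A (j + 1)" for j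
    unfolding A_def using assms(2) by (simp add: power2_eq_square algebra_simps)
  \<comment> \<open>At \<open>Re z = 1 / 2\<close> the pair (0,1) cancels exactly, so strict
    positivity is taken from the pair (2,3); hence \<open>m = 2\<close> below.\<close>
  have strict: "A 2 < A 3"
    unfolding A_def using assms(2) by (simp add: power2_eq_square algebra_simps)
  have "0 < Im (D_infty z) / - Im z"
  proof (rule alternating_sums_pos[where m = 2])
    show "(\<lambda>k. 1 / A (2 * k) - 1 / A (2 * k + 1)) sums (Im (D_infty z) / - Im z)"
      unfolding A_def by (rule Im_D_infty_sums(1)[OF assms(1)])
    show "1 / A (2 * k + 1) \<le> 1 / A (2 * k)" for k
      using A mono by (simp add: frac_le)
    have "1 / A 1 \<le> 1 / A 0" "1 / A 3 < 1 / A 2"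
      using A mono[of 0] strict by (simp_all add: frac_le frac_less2)
    then show "0 < (\<Sum>k<2. 1 / A (2 * k) - 1 / A (2 * k + 1))"
      by (simp add: numeral_2_eq_2 numeral_3_eq_3)
  qed
  then show ?thesis by auto
qed

text \<open>This is \<open>1 / A 0 - 1 / A 1 + 1 / A 2 - 1 / A 3 >= 0\<close> with denominators
  cleared. For \<open>x = 1\<close> it holds with equality at \<open>R = 3\<close> and fails just
  below, which explains the threshold 3.\<close>

lemma far_region_inequality:
  fixes x R :: real
  assumes "1 / 2 \<le> x" "x \<le> 1" "3 \<le> R"
  shows "(2 * x - 1) * ((4 - 4 * x + R) * (9 - 6 * x + R)) \<le> (5 - 2 * x) * (R * (1 - 2 * x + R))"
proof -
  \<comment> \<open>Expanded about the extremal corner \<open>x = 1\<close>, \<open>R = 3\<close>,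
    the difference of the two sides has only nonnegative coefficients.\<close>
  define p v where "p = 1 - x" and "v = R - 3"
  have pv: "0 \<le> p" "p \<le> 1 / 2" "0 \<le> v" and x: "x = 1 - p" and R: "R = v + 3"
    using assms by (auto simp: p_def v_def)
  have "(5 - 2 * x) * (R * (1 - 2 * x + R)) - (2 * x - 1) * ((4 - 4 * x + R) * (9 - 6 * x + R)) =
      6 * (1 + p) * (4 * p + 8 * p\<^sup>2) + v * (6 + 24 * p + 24 * p\<^sup>2) + v\<^sup>2 * (2 + 4 * p)"
    unfolding x R by (simp add: power2_eq_square algebra_simps)
  also have "\<dots> \<ge> 0"
    using pv by (intro add_nonneg_nonneg mult_nonneg_nonneg) auto
  finally show ?thesis by linarith
qed

text \<open>The summands are the pairs (1,2), (3,4), (5,6) of \<open>j / A j\<close>. Replacing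
  \<open>R\<close> by 3 bounds each from below and leaves an inequality in \<open>x\<close>
  alone.\<close>

lemma near_region_inequality:
  fixes x R :: real
  assumes x: "1 / 2 \<le> x" "x \<le> 1" and R: "x\<^sup>2 < R" "R \<le> 3"
  shows "0 < (2 - R) / ((1 - 2 * x + R) * (4 - 4 * x + R)) +
    (12 - R) / ((9 - 6 * x + R) * (16 - 8 * x + R)) +
    (30 - R) / ((25 - 10 * x + R) * (36 - 12 * x + R))"
proof -
  have R0: "0 < R" using R(1) zero_le_power2[of x] by linarith
  \<comment> \<open>Since \<open>R > x^2\<close>, the expression exceeds
    \<open>(1 - x)^2\<close>.\<close>
  have A1: "0 < 1 - 2 * x + R"
    using R(1) zero_le_power2[of "1 - x"] by (simp add: power2_eq_square algebra_simps)
  have A2: "0 < 4 - 4 * x + R" using x R0 by linarith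
  have "9 / ((12 - 6 * x) * (19 - 8 * x)) \<le> (12 - R) / ((9 - 6 * x + R) * (16 - 8 * x + R))"
    by (rule frac_le) (use x R R0 in \<open>auto intro!: mult_mono mult_pos_pos\<close>)
  \<comment> \<open>The denominator is largest at \<open>R = 3\<close>, \<open>x = 1 / 2\<close>,
    where its factors are 23 and 33.\<close>
  moreover have "27 / (23 * 33) \<le> (30 - R) / ((25 - 10 * x + R) * (36 - 12 * x + R))"
    by (rule frac_le) (use x R R0 in \<open>auto intro!: mult_pos_pos mult_mono simp del: numeral_times_numeral\<close>)
  moreover have "- (1 / ((4 - 2 * x) * (7 - 4 * x))) \<le> (2 - R) / ((1 - 2 * x + R) * (4 - 4 * x + R))"
  proof -
    \<comment> \<open>Both sides agree at \<open>R = 3\<close>, so the cleared difference has the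
      factor \<open>d\<close>.\<close>
    define d where "d = 3 - R"
    have d: "0 \<le> d" and R_eq: "R = 3 - d" using R by (auto simp: d_def)
    have "0 \<le> 8 * (1 - x)\<^sup>2 + 8 * (1 - x) + 1 + d"
      using x d by (intro add_nonneg_nonneg) auto
    then have "0 \<le> d * (8 * (1 - x)\<^sup>2 + 8 * (1 - x) + 1 + d)"
      using d by simp
    also have "\<dots> = (1 - 2 * x + R) * (4 - 4 * x + R) - (R - 2) * ((4 - 2 * x) * (7 - 4 * x))"
      unfolding R_eq by (simp add: power2_eq_square algebra_simps)
    finally have "(R - 2) * ((4 - 2 * x) * (7 - 4 * x)) \<le> 1 * ((1 - 2 * x + R) * (4 - 4 * x + R))"
      by linarith
    then have "(R - 2) / ((1 - 2 * x + R) * (4 - 4 * x + R)) \<le> 1 / ((4 - 2 * x) * (7 - 4 * x))"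
      by (intro mult_imp_div_pos_le) (use A1 A2 x in \<open>auto simp: pos_le_divide_eq\<close>)
    moreover have "(2 - R) / q = - ((R - 2) / q)" for q
      by (simp add: minus_divide_left)
    ultimately show ?thesis by (simp only: neg_le_iff_le)
  qed
  moreover have "1 / ((4 - 2 * x) * (7 - 4 * x)) < 9 / ((12 - 6 * x) * (19 - 8 * x)) + 27 / (23 * 33)"
  proof -
    \<comment> \<open>With \<open>12 - 6 * x = 3 * (4 - 2 * x)\<close> and
      \<open>27 / (23 * 33) = 9 / 253\<close>, the claim becomes a bound \<open>9 / 253\<close> on
      one fraction. Cleared of denominators, it says that a cubic in \<open>1 - x\<close> with
      positive coefficients is positive.\<close>
    have "0 < 9 * (1 - x) * (202 + 200 * (1 - x) + 64 * (1 - x)\<^sup>2) + 1012 * (1 - x) + 88"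
      using x by (intro add_nonneg_pos add_nonneg_nonneg mult_nonneg_nonneg) auto
    also have "\<dots> = 9 * ((4 - 2 * x) * (7 - 4 * x) * (19 - 8 * x)) - 253 * (4 * x - 2)"
      by (simp add: power2_eq_square algebra_simps)
    finally have "(4 * x - 2) / ((4 - 2 * x) * (7 - 4 * x) * (19 - 8 * x)) < 9 / 253"
      using x by (simp add: pos_divide_less_eq)
    moreover have "1 / (a * c) - 3 / (a * b) = (b - 3 * c) / (a * c * b)"
      if "a \<noteq> 0" "b \<noteq> 0" "c \<noteq> 0" for a b c :: real
      using that by (simp add: field_simps)
    from this[of "4 - 2 * x" "19 - 8 * x" "7 - 4 * x"]
    have "1 / ((4 - 2 * x) * (7 - 4 * x)) - 3 / ((4 - 2 * x) * (19 - 8 * x)) =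
        (4 * x - 2) / ((4 - 2 * x) * (7 - 4 * x) * (19 - 8 * x))"
      using x by simp
    moreover have "9 / ((12 - 6 * x) * (19 - 8 * x)) = 3 / ((4 - 2 * x) * (19 - 8 * x))"
    proof -
      have "(12 - 6 * x) * (19 - 8 * x) = 3 * ((4 - 2 * x) * (19 - 8 * x))"
        by (simp add: algebra_simps)
      moreover have "9 / (3 * q) = 3 / q" for q :: real
        by simp
      ultimately show ?thesis by (simp only:)
    qed
    ultimately show ?thesis by linarith
  qed
  ultimately show ?thesis by linarith
qed

lemma D_infty_nonzero_far:
  assumes "Im z \<noteq> 0" "1 / 2 \<le> Re z" "Re z \<le> 1" "3 \<le> (Re z)\<^sup>2 + (Im z)\<^sup>2"
  shows "D_infty z \<noteq> 0"
proof -
  define x R where "x = Re z" and "R = (Re z)\<^sup>2 + (Im z)\<^sup>2"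
  define A where "A = (\<lambda>j::nat. (real j - Re z)\<^sup>2 + (Im z)\<^sup>2)"
  have A: "0 < A j" for j
    unfolding A_def using assms(1) by (rule shifted_square_pos)
  have A_eq: "A j = (real j)\<^sup>2 - 2 * real j * x + R" for j
    unfolding A_def x_def R_def by (simp add: power2_eq_square algebra_simps)
  have less: "A j < A (j + 1)" if "j \<ge> 1" for j
  proof -
    have "A (j + 1) - A j = 2 * (real j - x) + 1"
      unfolding A_eq by (simp add: power2_eq_square algebra_simps)
    with that assms(3) show ?thesis by (simp add: x_def)
  qed
  have A0123: "A 0 = R" "A 1 = 1 - 2 * x + R" "A 2 = 4 - 4 * x + R" "A 3 = 9 - 6 * x + R"
    by (simp_all add: A_eq)
  have "(2 * x - 1) * (A 2 * A 3) \<le> (5 - 2 * x) * (A 0 * A 1)"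
    unfolding A0123 using assms by (intro far_region_inequality) (auto simp: x_def R_def)
  then have "(2 * x - 1) / (A 0 * A 1) \<le> (5 - 2 * x) / (A 2 * A 3)"
    using A by (intro mult_imp_div_pos_le) (auto simp: pos_le_divide_eq)
  moreover have "1 / A 0 - 1 / A 1 = - ((2 * x - 1) / (A 0 * A 1))"
    using A[of 0] A[of 1] by (simp add: A0123 divide_simps del: One_nat_def)
  moreover have "1 / A 2 - 1 / A 3 = (5 - 2 * x) / (A 2 * A 3)"
    using A[of 2] A[of 3] by (simp add: A0123 divide_simps)
  \<comment> \<open>The estimate for the first two pairs may be an equality, so strictness comes
    from the pair (4,5).\<close>
  moreover have "1 / A 5 < 1 / A 4"
    using A less[of 4] by (intro frac_less2) auto
  ultimately have init: "0 < 1 / A 0 - 1 / A 1 + (1 / A 2 - 1 / A 3) + (1 / A 4 - 1 / A 5)"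
    by linarith
  have "0 < Im (D_infty z) / - Im z"
  proof (rule alternating_sums_pos[where m = 3])
    show "(\<lambda>k. 1 / A (2 * k) - 1 / A (2 * k + 1)) sums (Im (D_infty z) / - Im z)"
      unfolding A_def by (rule Im_D_infty_sums(1)[OF assms(1)])
    show "1 / A (2 * k + 1) \<le> 1 / A (2 * k)" if "k \<ge> 3" for k
      using A less[of "2 * k"] that by (intro frac_le) auto
    show "0 < (\<Sum>k<3. 1 / A (2 * k) - 1 / A (2 * k + 1))"
      using init by (simp add: eval_nat_numeral)
  qed
  then show ?thesis by auto
qed

lemma D_infty_nonzero_near:
  assumes "Im z \<noteq> 0" "1 / 2 \<le> Re z" "Re z \<le> 1" "(Re z)\<^sup>2 + (Im z)\<^sup>2 \<le> 3"
  shows "D_infty z \<noteq> 0"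
proof -
  define x R where "x = Re z" and "R = (Re z)\<^sup>2 + (Im z)\<^sup>2"
  define A where "A = (\<lambda>j::nat. (real j - Re z)\<^sup>2 + (Im z)\<^sup>2)"
  have A: "0 < A j" for j
    unfolding A_def using assms(1) by (rule shifted_square_pos)
  have A_eq: "A j = (real j)\<^sup>2 - 2 * real j * x + R" for j
    unfolding A_def x_def R_def by (simp add: power2_eq_square algebra_simps)
  define f where "f = (\<lambda>j. real j / A j)"
  have f_diff: "f j - f (j + 1) = (real j * (real j + 1) - R) / (A j * A (j + 1))" for j
  proof -
    have "f j - f (j + 1) = (real j * A (j + 1) - (real j + 1) * A j) / (A j * A (j + 1))"
      unfolding f_def using A[of j] A[of "j + 1"] by (simp add: diff_frac_eq mult.commute)
    also have "real j * A (j + 1) - (real j + 1) * A j = real j * (real j + 1) - R"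
      unfolding A_eq by (simp add: power2_eq_square algebra_simps)
    finally show ?thesis .
  qed
  have "Im (z * D_infty z) / - Im z < 0"
  \<comment> \<open>Two regrouped pairs would not do: at \<open>x = 1\<close>, \<open>R = 3\<close>
    they add up to \<open>- 1/6 + 3/22 < 0\<close>.\<close>
  proof (rule alternating_sums_neg[where m = 3])
    show "(\<lambda>k. f (2 * k) - f (2 * k + 1)) sums (Im (z * D_infty z) / - Im z)"
      unfolding f_def A_def by (rule Im_D_infty_sums(2)[OF assms(1)])
    show "0 \<le> f (2 * k + 1)" for k
      unfolding f_def using A by (simp add: less_imp_le)
    show "f (2 * k + 2) \<le> f (2 * k + 1)" if "k \<ge> 3" for k
    proof -
      \<comment> \<open>For \<open>j = 2 * k + 1 >= 7\<close>, even the crude bound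
        \<open>j * (j + 1) >= 7\<close> exceeds \<open>R <= 3\<close>.\<close>
      have "7 * 1 \<le> real (2 * k + 1) * (real (2 * k + 1) + 1)"
        using that by (intro mult_mono) auto
      then have "0 \<le> f (2 * k + 1) - f (2 * k + 1 + 1)"
        unfolding f_diff using A[of "2 * k + 1"] A[of "2 * k + 1 + 1"] assms(4)
        by (intro divide_nonneg_pos mult_pos_pos) (auto simp: R_def)
      then show ?thesis by simp
    qed
    have "f 0 = 0" by (simp add: f_def)
    also have "0 < (f 1 - f 2) + (f 3 - f 4) + (f 5 - f 6)"
    proof -
      have "f 1 - f 2 = (2 - R) / ((1 - 2 * x + R) * (4 - 4 * x + R))"
        using f_diff[of 1, unfolded one_add_one] by (simp add: A_eq del: One_nat_def)
      moreover have "f 3 - f 4 = (12 - R) / ((9 - 6 * x + R) * (16 - 8 * x + R))"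
        using f_diff[of 3] by (simp add: A_eq)
      moreover have "f 5 - f 6 = (30 - R) / ((25 - 10 * x + R) * (36 - 12 * x + R))"
        using f_diff[of 5] by (simp add: A_eq)
      ultimately show ?thesis
        using near_region_inequality[of x R] assms by (simp add: x_def R_def)
    qed
    also have "\<dots> = (\<Sum>k<3. f (2 * k + 1) - f (2 * k + 2))"
      by (simp add: eval_nat_numeral)
    finally show "f 0 < (\<Sum>k<3. f (2 * k + 1) - f (2 * k + 2))" .
  qed
  then show ?thesis by auto
qed

lemma D_infty_nonzero_nonreal:
  assumes "Im z \<noteq> 0" "Re z \<le> 1"
  shows "D_infty z \<noteq> 0"
proof -
  consider "Re z \<le> 1 / 2" | "1 / 2 \<le> Re z" "3 \<le> (Re z)\<^sup>2 + (Im z)\<^sup>2"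
    | "1 / 2 \<le> Re z" "(Re z)\<^sup>2 + (Im z)\<^sup>2 \<le> 3"
    by linarith
  then show ?thesis
  proof cases
    case 1
    with assms(1) show ?thesis by (rule D_infty_nonzero_left)
  next
    case 2
    with assms show ?thesis by (intro D_infty_nonzero_far)
  next
    case 3
    with assms show ?thesis by (intro D_infty_nonzero_near)
  qed
qed

section \<open>The real axis\<close>

lemma D_infty_nonzero_real:
  assumes "Im z = 0" "Re z < 1" "Re z \<noteq> 0"
  shows "D_infty z \<noteq> 0"
proof -
  define x where "x = Re z"
  have z: "z = of_real x"
    using assms(1) by (simp add: complex_eq_iff x_def)
  have "z \<notin> \<nat>"
  proof
    assume "z \<in> \<nat>"
    then obtain n where "z = of_nat n" by (auto elim: Nats_cases)
    with assms show False by (cases n) auto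
  qed
  note D = sums_minus[OF sums_Re[OF D_infty_sums(1)[OF this]]]
  have s: "(\<lambda>k. 1 / (real (2 * k) - x) - 1 / (real (2 * k + 1) - x)) sums (- Re (D_infty z))"
  proof (rule sums_cong[THEN iffD1, OF _ D])
    have "Re (1 / (z - of_nat j)) = - (1 / (real j - x))" for j
    proof -
      have "1 / (z - of_nat j) = of_real (1 / (x - real j))" by (simp add: z)
      then show ?thesis by (simp add: minus_divide_right)
    qed
    then show "- Re (1 / (z - of_nat (2 * k)) - 1 / (z - of_nat (2 * k + 1))) =
        1 / (real (2 * k) - x) - 1 / (real (2 * k + 1) - x)" for k
      by (simp only: minus_complex.sel)
  qed
  have x: "x < 1" "x \<noteq> 0" using assms by (auto simp: x_def)
  show ?thesis
  proof (cases "x < 0")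
    case True
    have "1 / (1 - x) < 1 / (0 - x)"
      using True by (intro frac_less2) auto
    then have "0 < - Re (D_infty z)"
      by (intro alternating_sums_pos[OF s, where m = 1]) (use True in \<open>auto intro!: frac_le\<close>)
    then show ?thesis by auto
  next
    case False
    with x have x': "0 < x" by simp
    \<comment> \<open>For \<open>0 < x < 1\<close> only the term with \<open>j = 0\<close> is
      negative; the regrouped pairs merely lower the sum further, so \<open>m = 0\<close>
      suffices.\<close>
    have "- Re (D_infty z) < 0"
      by (rule alternating_sums_neg[OF s, where m = 0]) (use x x' in \<open>auto intro!: frac_le\<close>)
    then show ?thesis by auto
  qed
qed

section \<open>The integral for \<open>Re z < 0\<close>\<close>

lemma has_integral_powr_complex:
  assumes "Re w > 0"
  shows "((\<lambda>t. of_real t powr (w - 1)) has_integral 1 / w) {0..1}"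
proof -
  have "((\<lambda>t. complex_of_real t powr (w - 1)) has_integral
          (of_real 1 powr w / w - of_real 0 powr w / w)) {0..1}" using assms
    by (intro fundamental_theorem_of_calculus_interior)
       (auto intro!: continuous_intros derivative_eq_intros has_vector_derivative_real_field)
  then show ?thesis by simp
qed

lemma alternating_geometric_sum:
  fixes c :: "'a :: field"
  assumes "1 + c \<noteq> 0"
  shows "(\<Sum>k<n. c ^ (2 * k) - c ^ (2 * k + 1)) = (1 - c ^ (2 * n)) / (1 + c)"
  using assms by (induction n) (simp_all add: field_simps power_add power2_eq_square)

lemma integral_eq_D_infty:
  assumes "Re z < 0"
  shows "integral {0..1} (\<lambda>t::real. 2 / (1 + of_real t) * of_real t powr (- z - 1)) = - 2 * D_infty z"
proof -
  have "z \<notin> \<nat>"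
    using assms by (auto elim!: Nats_cases)
  note s = D_infty_sums(1)[OF this]
  define F where "F = (\<lambda>n (t::real). \<Sum>k<n.
     of_real t powr (of_nat (2 * k) - z - 1) - of_real t powr (of_nat (2 * k + 1) - z - 1) :: complex)"
  \<comment> \<open>Every \<open>F n\<close> vanishes at \<open>t = 1\<close>, so the pointwise
    limit is 0 there and differs from half the integrand at that single point.\<close>
  define g where "g = (\<lambda>t::real. if t = 1 then 0 else 1 / (1 + of_real t) * of_real t powr (- z - 1) :: complex)"
  have F_eq: "F n t = of_real (1 - t ^ (2 * n)) * (1 / (1 + of_real t) * of_real t powr (- z - 1))"
    if "0 \<le> t" for n t
  \<comment> \<open>At \<open>t = 0\<close> both sides are 0, because
    \<open>0 powr w = 0\<close>.\<close>
  proof (cases "t = 0")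
    case False
    have pw: "of_real t powr (of_nat j - z - 1) = of_real t ^ j * of_real t powr (- z - 1)" for j
    proof -
      have "of_real t powr (of_nat j - z - 1) = of_real t powr (of_nat j + (- z - 1))"
        by (simp add: algebra_simps)
      then show ?thesis
        using False by (simp only: powr_add) (simp add: powr_nat)
    qed
    have ne: "1 + complex_of_real t \<noteq> 0"
      using that by (metis add_nonneg_eq_0_iff of_real_1 of_real_add of_real_eq_0_iff zero_le_one zero_neq_one)
    have "F n t = (\<Sum>k<n. of_real t ^ (2 * k) - of_real t ^ (2 * k + 1)) * of_real t powr (- z - 1)"
      unfolding F_def pw sum_distrib_right left_diff_distrib ..
    also have "\<dots> = (1 - of_real t ^ (2 * n)) / (1 + of_real t) * of_real t powr (- z - 1)"
      by (simp only: alternating_geometric_sum[OF ne])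
    finally show ?thesis by simp
  qed (simp add: F_def)
  have "(g has_integral - D_infty z) {0..1}"
  proof (rule has_integral_dominated_convergence)
    show "(F n has_integral (\<Sum>k<n. 1 / (of_nat (2 * k) - z) - 1 / (of_nat (2 * k + 1) - z))) {0..1}" for n
      unfolding F_def using assms
      by (intro has_integral_sum has_integral_diff has_integral_powr_complex) auto
    \<comment> \<open>A dominating function: the factors \<open>1 - t ^ (2 * n)\<close> and
      \<open>1 / (1 + t)\<close> lie in [0,1], and \<open>Re z < 0\<close> makes the remaining power
      integrable at 0.\<close>
    show "(\<lambda>t. t powr (- Re z - 1)) integrable_on {0..1}"
      using assms by (intro integrable_on_powr_from_0) auto
    show "\<forall>t\<in>{0..1}. norm (F n t) \<le> t powr (- Re z - 1)" for n
    proof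
      fix t :: real assume t: "t \<in> {0..1}"
      have "t ^ (2 * n) \<le> 1" "0 \<le> t ^ (2 * n)" using t by (auto intro: power_le_one)
      then have "norm (F n t) = (1 - t ^ (2 * n)) * (1 / (1 + t) * t powr (- Re z - 1))"
      proof -
        have "norm (1 + complex_of_real t) = 1 + t"
          using t by (metis abs_of_nonneg add_nonneg_nonneg atLeastAtMost_iff norm_of_real of_real_1
              of_real_add zero_le_one)
        moreover have "norm (complex_of_real (1 - t ^ (2 * n))) = 1 - t ^ (2 * n)"
          using \<open>t ^ (2 * n) \<le> 1\<close> by (simp only: norm_of_real)
        moreover have "norm (complex_of_real t powr (- z - 1)) = t powr (- Re z - 1)"
          using t by (subst norm_powr_real_powr) auto
        ultimately show ?thesis
          using t by (simp add: F_eq norm_mult norm_divide del: of_real_diff of_real_power)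
      qed
      also have "\<dots> \<le> 1 * (1 * t powr (- Re z - 1))"
        using t \<open>t ^ (2 * n) \<le> 1\<close> \<open>0 \<le> t ^ (2 * n)\<close> by (intro mult_mono) auto
      finally show "norm (F n t) \<le> t powr (- Re z - 1)" by simp
    qed
    show "\<forall>t\<in>{0..1}. (\<lambda>n. F n t) \<longlonglongrightarrow> g t"
    proof
      fix t :: real assume t: "t \<in> {0..1}"
      show "(\<lambda>n. F n t) \<longlonglongrightarrow> g t"
      proof (cases "t = 1")
        case True
        then show ?thesis by (simp add: F_eq g_def)
      next
        case False
        have lim: "(\<lambda>n. (t\<^sup>2) ^ n) \<longlonglongrightarrow> 0"
          using t False by (intro LIMSEQ_power_zero) (auto simp: power_less_one_iff abs_square_less_1)
        have "(\<lambda>n. of_real (1 - t ^ (2 * n)) * (1 / (1 + of_real t) * of_real t powr (- z - 1)))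
            \<longlonglongrightarrow> complex_of_real (1 - 0) * (1 / (1 + of_real t) * of_real t powr (- z - 1))"
          unfolding power_mult by (intro tendsto_mult tendsto_of_real tendsto_diff tendsto_const lim)
        then show ?thesis
          using t False by (simp add: F_eq g_def)
      qed
    qed
    have "1 / (of_nat j - z) = - (1 / (z - of_nat j))" for j
      by (simp add: minus_divide_right)
    then have "(\<Sum>k<n. 1 / (of_nat (2 * k) - z) - 1 / (of_nat (2 * k + 1) - z)) =
        - (\<Sum>k<n. 1 / (z - of_nat (2 * k)) - 1 / (z - of_nat (2 * k + 1)))" for n
      unfolding sum_negf[symmetric] by (simp only: minus_diff_minus)
    then show "(\<lambda>n. \<Sum>k<n. 1 / (of_nat (2 * k) - z) - 1 / (of_nat (2 * k + 1) - z)) \<longlonglongrightarrow> - D_infty z"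
      using tendsto_minus[OF s[unfolded sums_def]] by (simp only:)
  qed
  then have "((\<lambda>t. 2 * g t) has_integral 2 * - D_infty z) {0..1}"
    by (rule has_integral_mult_right)
  then have "((\<lambda>t. 2 / (1 + of_real t) * of_real t powr (- z - 1)) has_integral 2 * - D_infty z) {0..1}"
    by (rule has_integral_spike_finite[of "{1}", rotated 2]) (auto simp: g_def)
  then show ?thesis by (simp add: integral_unique)
qed

section \<open>Uniqueness of the meromorphic continuation\<close>

text \<open>A difference of nicely meromorphic functions need not be nice, so the identity theorem
  is applied to \<open>remove_sings\<close> of it. This gives \<open>f = g\<close> on a punctured
  neighbourhood of each point; at the point itself either both have a pole, with value 0, or both
  are continuous.\<close>

lemma nicely_meromorphic_identity:
  assumes f: "f nicely_meromorphic_on A" and g: "g nicely_meromorphic_on A"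
    and A: "open A" "connected A" and U: "open U" "U \<noteq> {}" "U \<subseteq> A"
    and eq: "\<And>z. z \<in> U \<Longrightarrow> f z = g z" and z: "z \<in> A"
  shows "f z = g z"
proof -
  let ?h = "\<lambda>z. f z - g z"
  have mero: "?h meromorphic_on A"
    using f g by (auto simp: nicely_meromorphic_on_def intro!: meromorphic_intros)
  obtain u where u: "u \<in> U" using U by blast
  have "eventually (\<lambda>w. w \<in> U) (at u)"
    using U u by (intro eventually_at_in_open') auto
  then have ev: "eventually (\<lambda>w. ?h w = 0) (at u)"
    by eventually_elim (simp add: eq)
  have evr: "eventually (\<lambda>w. remove_sings ?h w = ?h w) (at v)" if "v \<in> A" for v
    using mero that by (intro eventually_remove_sings_eq_at) (metis meromorphic_onE)
  have "eventually (\<lambda>w. remove_sings ?h w = 0) (at u)"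
    using ev evr[of u, OF subsetD[OF U(3) u]] by eventually_elim simp
  then have "frequently (\<lambda>w. remove_sings ?h w = 0) (at u)"
    by (intro eventually_frequently) auto
  then have zero: "remove_sings ?h w = 0" if "w \<in> A" for w
    using frequently_eq_meromorphic_imp_constant[OF _ remove_sings_nicely_meromorphic[OF mero] A]
      u U that by blast
  have "eventually (\<lambda>w. w \<in> A) (at z)"
    using A z by (intro eventually_at_in_open') auto
  with evr[OF z] have ev_z: "eventually (\<lambda>w. f w = g w) (at z)"
    by eventually_elim (use zero in auto)
  have pole: "is_pole f z \<longleftrightarrow> is_pole g z"
    using ev_z by (intro is_pole_cong) auto
  have lim: "f \<midarrow>z\<rightarrow> c \<longleftrightarrow> g \<midarrow>z\<rightarrow> c" for c
    using ev_z by (intro tendsto_cong)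
  show ?thesis
  proof (cases "is_pole f z")
    case True
    then have "f z = 0" "g z = 0"
      using f g z pole by (auto dest: is_pole_zero_at_nicely_mero)
    then show ?thesis by simp
  next
    case False
    then have "f \<midarrow>z\<rightarrow> f z" "g \<midarrow>z\<rightarrow> g z"
      using f g z pole by (auto simp: nicely_meromorphic_on_def)
    then show ?thesis
      using lim[of "f z"] by (metis LIM_unique)
  qed
qed

section \<open>The digamma formula as the continuation\<close>

text \<open>Near every point, \<open>Digamma\<close> agrees off that point with the quotient
  \<open>- deriv rGamma / rGamma\<close> of entire functions.\<close>

lemma meromorphic_on_Digamma: "(Digamma :: complex \<Rightarrow> complex) meromorphic_on A"
proof -
  have "(Digamma :: complex \<Rightarrow> complex) meromorphic_on UNIV"
  proof -
    have an: "(rGamma :: complex \<Rightarrow> complex) analytic_on UNIV"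
      by (simp add: analytic_on_open holomorphic_rGamma)
    have "(\<lambda>z::complex. - deriv rGamma z / rGamma z) meromorphic_on UNIV"
      using an by (intro meromorphic_intros analytic_on_imp_meromorphic_on analytic_deriv)
    moreover have "eventually (\<lambda>w. - deriv rGamma w / rGamma w = Digamma w) (at z)" for z :: complex
    proof -
      \<comment> \<open>The nonpositive integers other than \<open>z\<close> form a closed set, so a
        punctured neighbourhood of \<open>z\<close> avoids them all.\<close>
      have "eventually (\<lambda>w. w \<in> - (\<int>\<^sub>\<le>\<^sub>0 - {z})) (at z)"
        by (intro eventually_at_in_open' open_Compl closed_subset_Ints)
          (use nonpos_Ints_subset_Ints in auto)
      moreover have "eventually (\<lambda>w. w \<noteq> z) (at z)"
        by (rule eventually_neq_at_within)
      ultimately show ?thesis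
      proof eventually_elim
        case (elim w)
        then have w: "w \<notin> \<int>\<^sub>\<le>\<^sub>0" by auto
        then have "deriv rGamma w = - rGamma w * Digamma w"
          by (intro DERIV_imp_deriv has_field_derivative_rGamma_no_nonpos_int)
        with w show ?case by (simp add: rGamma_eq_zero_iff)
      qed
    qed
    ultimately show ?thesis
      by (rule meromorphic_on_cong[THEN iffD1, rotated 2]) auto
  qed
  then show ?thesis by (rule meromorphic_on_subset) auto
qed

text \<open>At 0 this total formula has value 0 but limit 2, so it is not nicely meromorphic; the
  continuation is \<open>remove_sings g_psi\<close>.\<close>

definition g_psi :: "complex \<Rightarrow> complex" where
  "g_psi z = z * (Digamma (- z / 2) - Digamma ((1 - z) / 2))"

lemma meromorphic_on_g_psi: "g_psi meromorphic_on UNIV"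
proof -
  have "(\<lambda>z. Digamma (- z / 2)) meromorphic_on UNIV" "(\<lambda>z. Digamma ((1 - z) / 2)) meromorphic_on UNIV"
    by (rule meromorphic_on_compose[OF meromorphic_on_Digamma[of UNIV]];
        auto intro!: analytic_intros)+
  then show ?thesis
    unfolding g_psi_def [abs_def] by (intro meromorphic_intros)
qed

lemma analytic_at_g_psi:
  assumes "z \<notin> \<nat>"
  shows "g_psi analytic_on {z}"
proof -
  have op: "open (- \<nat> :: complex set)"
    by (simp add: open_Compl closed_subset_Ints Nats_subset_Ints)
  have "g_psi field_differentiable at w" if "w \<notin> \<nat>" for w
  proof -
    have "- w / 2 \<notin> \<int>\<^sub>\<le>\<^sub>0" 
    proof
      assume "- w / 2 \<in> \<int>\<^sub>\<le>\<^sub>0"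
      then obtain n where "- w / 2 = - of_nat n" by (auto elim!: nonpos_Ints_cases')
      then have "w = of_nat (2 * n)" by (simp add: field_simps)
      with that show False by (metis of_nat_in_Nats)
    qed
    moreover have "(1 - w) / 2 \<notin> \<int>\<^sub>\<le>\<^sub>0"
    proof
      assume "(1 - w) / 2 \<in> \<int>\<^sub>\<le>\<^sub>0"
      then obtain n where "(1 - w) / 2 = - of_nat n" by (auto elim!: nonpos_Ints_cases')
      then have "w = of_nat (2 * n + 1)" by (simp add: field_simps)
      with that show False by (metis of_nat_in_Nats)
    qed
    ultimately show ?thesis
      unfolding g_psi_def [abs_def] field_differentiable_def
      by (auto intro!: exI derivative_eq_intros)
  qed
  then have "g_psi holomorphic_on - \<nat>"
    by (auto simp: holomorphic_on_def intro: field_differentiable_at_within)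
  with op assms show ?thesis
    by (auto simp: analytic_at)
qed

text \<open>Existence comes from the integral evaluation on the left half-plane, uniqueness from the
  identity theorem started there.\<close>

lemma g_star_eq: "g_star = remove_sings g_psi"
  unfolding g_star_def
proof (rule the_equality)
  let ?I = "\<lambda>z. - z * integral {0..1} (\<lambda>t::real. 2 / (1 + of_real t) * of_real t powr (- z - 1))"
  have nice: "remove_sings g_psi nicely_meromorphic_on UNIV"
    by (rule remove_sings_nicely_meromorphic[OF meromorphic_on_g_psi])
  have int: "remove_sings g_psi z = ?I z" if "Re z < 0" for z
  proof -
    have "z \<notin> \<nat>"
      using that by (auto elim!: Nats_cases)
    then have "remove_sings g_psi z = z * (2 * D_infty z)"
      using D_infty_sums(2) analytic_at_g_psi by (simp add: g_psi_def)
    then show ?thesis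
      unfolding integral_eq_D_infty[OF that] by simp
  qed
  show "remove_sings g_psi nicely_meromorphic_on UNIV \<and> (\<forall>z. Re z < 0 \<longrightarrow> remove_sings g_psi z = ?I z)"
    using nice int by blast
  fix g assume g: "g nicely_meromorphic_on UNIV \<and> (\<forall>z. Re z < 0 \<longrightarrow> g z = ?I z)"
  have "{z. Re z < 0} \<noteq> {}"
    by (auto intro: exI[of _ "-1"])
  moreover have "g w = remove_sings g_psi w" if "w \<in> {z. Re z < 0}" for w
    using that g int[of w] by (metis mem_Collect_eq)
  ultimately have "g z = remove_sings g_psi z" for z
    by (rule nicely_meromorphic_identity[OF conjunct1[OF g] nice open_UNIV connected_UNIV
          open_halfspace_Re_lt _ subset_UNIV _ UNIV_I])
  then show "g = remove_sings g_psi" by blast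
qed

section \<open>Behaviour at the points 0 and 1\<close>

text \<open>The recurrence at \<open>- z / 2\<close> splits off the pole \<open>2 / z\<close>;
  multiplied by \<open>z\<close>, it contributes the limit 2, while the rest is continuous and
  vanishes at 0.\<close>

lemma g_psi_tendsto_0: "g_psi \<midarrow>0\<rightarrow> 2"
proof -
  have "(\<lambda>z. 2 + z * (Digamma (1 - z / 2) - Digamma ((1 - z) / 2))) \<midarrow>0\<rightarrow>
      2 + 0 * (Digamma (1 - 0 / 2) - Digamma ((1 - 0) / 2) :: complex)"
  proof (rule isContD, intro continuous_intros)
    show "(1 - 0 / 2 :: complex) \<notin> \<int>\<^sub>\<le>\<^sub>0" "((1 - 0) / 2 :: complex) \<notin> \<int>\<^sub>\<le>\<^sub>0"
      by (auto elim!: nonpos_Ints_cases simp: complex_eq_iff)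
  qed auto
  moreover have "eventually (\<lambda>z. 2 + z * (Digamma (1 - z / 2) - Digamma ((1 - z) / 2)) = g_psi z) (at 0)"
    using eventually_neq_at_within[of 0 0 UNIV]
  proof eventually_elim
    case (elim z)
    then show ?case
      using Digamma_plus1[of "- z / 2"] by (simp add: g_psi_def field_simps)
  qed
  ultimately show ?thesis
    by (auto intro: Lim_transform_eventually)
qed

text \<open>The recurrence at \<open>(1 - z) / 2\<close> isolates the singular part at 1. The
  nonzero limit shows that 1 is a genuine pole.\<close>

lemma g_psi_residue_1: "(\<lambda>z. (z - 1) * g_psi z) \<midarrow>1\<rightarrow> - 2"
proof -
  have "(\<lambda>z. z * ((z - 1) * (Digamma (- z / 2) - Digamma ((3 - z) / 2)) - 2)) \<midarrow>1\<rightarrow>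
      1 * ((1 - 1) * (Digamma (- 1 / 2) - Digamma ((3 - 1) / 2)) - 2 :: complex)"
  proof (rule isContD, intro continuous_intros)
    show "(- 1 / 2 :: complex) \<notin> \<int>\<^sub>\<le>\<^sub>0"
    proof
      assume "(- 1 / 2 :: complex) \<in> \<int>\<^sub>\<le>\<^sub>0"
      then obtain n where "(- 1 / 2 :: complex) = - of_nat n" by (auto elim!: nonpos_Ints_cases')
      then have "complex_of_nat 1 = of_nat (2 * n)" by (simp add: field_simps)
      then have "1 = 2 * n" by (simp only: of_nat_eq_iff)
      then show False by presburger
    qed
    show "((3 - 1) / 2 :: complex) \<notin> \<int>\<^sub>\<le>\<^sub>0"
      by (auto elim!: nonpos_Ints_cases simp: complex_eq_iff)
  qed auto
  moreover have "eventually (\<lambda>z. z * ((z - 1) * (Digamma (- z / 2) - Digamma ((3 - z) / 2)) - 2) =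
      (z - 1) * g_psi z) (at 1)"
    using eventually_neq_at_within[of 1 1 UNIV]
  proof eventually_elim
    case (elim z)
    then have "Digamma ((3 - z) / 2) = Digamma ((1 - z) / 2) + 2 / (1 - z)"
      using Digamma_plus1[of "(1 - z) / 2"] by (simp add: field_simps)
    with elim have "(z - 1) * Digamma ((3 - z) / 2) = (z - 1) * Digamma ((1 - z) / 2) - 2"
      by (simp add: field_simps)
    then show ?case
      unfolding g_psi_def by algebra
  qed
  ultimately show ?thesis
    by (auto intro: Lim_transform_eventually)
qed

text \<open>The continuation takes the conventional value 0 at its pole 1, so only failure of
  analyticity keeps 1 from being a zero. A finite limit there would force
  \<open>(z - 1) * g_psi z\<close> to tend to 0 instead of -2.\<close>

lemma not_analytic_g_star_1: "\<not> g_star analytic_on {1}"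
proof
  assume "g_star analytic_on {1}"
  then have "g_star \<midarrow>1\<rightarrow> g_star 1"
    using analytic_at_imp_isCont isContD by blast
  moreover have "eventually (\<lambda>w. remove_sings g_psi w = g_psi w) (at 1)"
    using meromorphic_on_g_psi by (intro eventually_remove_sings_eq_at) (metis meromorphic_onE UNIV_I)
  ultimately have "g_psi \<midarrow>1\<rightarrow> g_star 1"
    unfolding g_star_eq by (auto intro: Lim_transform_eventually)
  then have "(\<lambda>z. (z - 1) * g_psi z) \<midarrow>1\<rightarrow> (1 - 1) * g_star 1"
    by (intro tendsto_intros)
  with g_psi_residue_1 show False
    by (auto dest: LIM_unique)
qed

theorem theorem3p3:
  shows "(\<forall>z. 0 < Re z \<and> Re z \<le> 1 \<and> Im z > 0 \<longrightarrow> D_infty z \<noteq> 0) \<and>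
    (\<forall>z. z \<notin> \<nat> \<longrightarrow> g_star z = z * (Digamma (- z / 2) - Digamma ((1 - z) / 2))) \<and>
    (\<forall>z. Re z \<le> 1 \<longrightarrow> \<not> is_zero_of g_star z)"
proof (intro conjI allI impI)
  show "D_infty z \<noteq> 0" if "0 < Re z \<and> Re z \<le> 1 \<and> Im z > 0" for z
    using that by (intro D_infty_nonzero_nonreal) auto
  show g: "g_star z = z * (Digamma (- z / 2) - Digamma ((1 - z) / 2))" if "z \<notin> \<nat>" for z
    using analytic_at_g_psi[OF that] by (simp add: g_star_eq g_psi_def)
  show "\<not> is_zero_of g_star z" if "Re z \<le> 1" for z
  proof (cases "z \<in> \<nat>")
    case True
    then obtain n where n: "z = of_nat n" by (auto elim: Nats_cases)
    with that have "z = 0 \<or> z = 1" by (cases n) auto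
    then show ?thesis
    proof
      assume "z = 0"
      then have "g_star z = 2"
        using g_psi_tendsto_0 by (auto simp: g_star_eq)
      then show ?thesis by (simp add: is_zero_of_def)
    next
      assume "z = 1"
      then show ?thesis
        using not_analytic_g_star_1 by (simp add: is_zero_of_def)
    qed
  next
    case False
    \<comment> \<open>The real-axis result excludes \<open>Re z = 0\<close> and needs
      \<open>Re z < 1\<close>; a real \<open>z\<close> outside the naturals is neither 0 nor
      1.\<close>
    have "Re z \<noteq> 0 \<and> Re z \<noteq> 1" if "Im z = 0"
      using that False by (metis Nats_0 Nats_1 complex_is_Real_iff of_real_0 of_real_1 of_real_Re)
    then have "D_infty z \<noteq> 0"
      using D_infty_nonzero_nonreal[of z] D_infty_nonzero_real[of z] that by (cases "Im z = 0") auto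
    moreover have "z \<noteq> 0" using False by auto
    ultimately have "g_star z \<noteq> 0"
      using g[OF False] D_infty_sums(2)[OF False] by simp
    then show ?thesis by (simp add: is_zero_of_def)
  qed
qed

end
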